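(* Let $g$ be a Lorentzian metric on a 4-dimensional spacetime and let $h(x,p)$ be a smooth function which is homogeneous of degree $n$ in $p$, i.e. $h(x,\lambda p)=\lambda^nh(x,p)$ for $\lambda>0$. Consider the modified dispersion relation $$H(x,p)=g^{ab}(x)p_ap_b+\Xi(M)\,h(x,p)=M^2$$ with coupling $\Xi(M)$ possibly depending on the particle mass $M>0$. Then, to first order in the perturbation, the spatial acceleration of a particle of mass $M$ has the form $\vec a=\vec a_{\rm GR}+\Delta\vec a$ with $$\Delta\vec a=\Xi(M)\,M^{n-2}\,\Delta\vec{\hat a},$$ where $\vec a_{\rm GR}$ and $\Delta\vec{\hat a}$ are independent of $M$, and, wherever $\vec a_{\rm GR}\neq0$, the Eötvös factor of two test bodies of masses $M_1,M_2$ in the same gravitational field and state of motion is, to first order in the perturbation, $$\eta=\left|\Xi(M_1)M_1^{n-2}-\Xi(M_2)M_2^{n-2}\right|\frac{|\Delta\vec{\hat a}|}{|\vec a_{\rm GR}|}.$$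
   Context: Indices $a,b,\dots$ run over $0,\dots,3$ and $\alpha,\beta,\dots$ over $1,2,3$; the signature is $(+,-,-,-)$; coordinates are $x^a=(ct,x^\alpha)$, $v^\alpha=dx^\alpha/dt$, $\epsilon^\alpha=v^\alpha/c$. The Eötvös factor of two bodies with spatial accelerations $\vec a_1,\vec a_2$ is $$\eta=2\frac{|\vec a_1-\vec a_2|}{|\vec a_1+\vec a_2|},$$ where the absolute values are norms taken with respect to the (unperturbed, mass-independent) spatial metric. The motion of a particle of mass $M$ subject to the dispersion relation is, to first order in $\Xi$, determined by the spatial Lagrangian $$f=\mathfrak f\left(1-\frac{\Xi}{2M^2}\bar h\right),\quad \mathfrak f=\sqrt{g_{00}+2g_{0\alpha}\epsilon^\alpha+g_{\alpha\beta}\epsilon^\alpha\epsilon^\beta},\quad \bar h=h(ct,x^\alpha,\bar p),\quad \bar p_c=\frac{M(g_{c0}+g_{c\alpha}\epsilon^\alpha)}{\mathfrak f},$$ through $$f_{\alpha\beta}\frac{d^2x^\beta}{dt^2}=c^2\partial_\alpha f-c\,(\partial_tf_\alpha+v^\gamma\partial_\gamma f_\alpha),$$ expanded to first order in $\Xi$; lower indices on $f$ and $\mathfrak f$ denote derivatives with respect to $\epsilon^\alpha$, $\partial_t,\partial_\alpha$ denote derivatives with respect to $t,x^\alpha$ at fixed $\epsilon$, and $\mathfrak f_{\alpha\beta}$ is assumed invertible. The vector $\vec a_{\rm GR}$ is the acceleration obtained for $\Xi=0$ and $\Delta\vec a$ is the term of first order in $\Xi$. *)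

theory Defs
  imports "HOL-Analysis.Analysis" "HOL-Library.Landau_Symbols"
begin

(* Meant for open S only: derivatives are taken at interior points. *)
fun differentiable_of_order ::
  "nat \<Rightarrow> 'a::real_normed_vector set \<Rightarrow> ('a \<Rightarrow> 'b::real_normed_vector) \<Rightarrow> bool" where
  "differentiable_of_order 0 S f \<longleftrightarrow> continuous_on S f"
| "differentiable_of_order (Suc k) S f \<longleftrightarrow>
     (\<forall>x\<in>S. f differentiable (at x)) \<and>
     (\<forall>v. differentiable_of_order k S (\<lambda>x. frechet_derivative f (at x) v))"

definition smooth_on :: "'a::real_normed_vector set \<Rightarrow> ('a \<Rightarrow> 'b::real_normed_vector) \<Rightarrow> bool" where
  "smooth_on S f \<longleftrightarrow> (\<forall>k. differentiable_of_order k S f)"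

(* Spacetime indices are the elements 0, 1, 2, 3 of type 4; spatial indices are the elements
   1, 2, 3 of type 3. Vectors and covectors are both represented by their components. *)
definition four :: "real \<Rightarrow> real^3 \<Rightarrow> real^4" where
  "four s w = (\<chi> a. if a = 0 then s else if a = 1 then w$1 else if a = 2 then w$2 else w$3)"

definition minkowski :: "real^4^4" where
  "minkowski = (\<chi> a b. if a \<noteq> b then 0 else if a = 0 then 1 else -1)"

definition lorentzian :: "real^4^4 \<Rightarrow> bool" where
  "lorentzian G \<longleftrightarrow> transpose G = G \<and>
     (\<exists>E::real^4^4. invertible E \<and> transpose E ** G ** E = minkowski)"

definition lorentzian_metric_on :: "(real^4) set \<Rightarrow> (real^4 \<Rightarrow> real^4^4) \<Rightarrow> bool" where
  "lorentzian_metric_on U g \<longleftrightarrow> smooth_on U g \<and> (\<forall>X\<in>U. lorentzian (g X))"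

(* D is the domain in phase space (position, momentum) on which h is defined. *)
definition conic_domain :: "(real^4) set \<Rightarrow> ((real^4) \<times> (real^4)) set \<Rightarrow> bool" where
  "conic_domain U D \<longleftrightarrow> open D \<and> D \<subseteq> U \<times> UNIV \<and>
     (\<forall>X p. \<forall>r>0. (X, p) \<in> D \<longrightarrow> (X, r *\<^sub>R p) \<in> D)"

definition homogeneous_of_degree ::
  "real \<Rightarrow> ((real^4) \<times> (real^4)) set \<Rightarrow> (real^4 \<Rightarrow> real^4 \<Rightarrow> real) \<Rightarrow> bool" where
  "homogeneous_of_degree n D h \<longleftrightarrow>
     (\<forall>(X, p)\<in>D. \<forall>r>0. h X (r *\<^sub>R p) = r powr n * h X p)"

(* Lagrangians are functions of t, the spatial coordinates x, and \<epsilon> = v / c; here e = \<epsilon>.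
   For symmetric g, gr_radicand is g_00 + 2 g_0\<alpha> \<epsilon>^\<alpha> + g_\<alpha>\<beta> \<epsilon>^\<alpha> \<epsilon>^\<beta>. *)
definition gr_radicand :: "real \<Rightarrow> (real^4 \<Rightarrow> real^4^4) \<Rightarrow> real \<Rightarrow> real^3 \<Rightarrow> real^3 \<Rightarrow> real" where
  "gr_radicand c g t x e = four 1 e \<bullet> (g (four (c * t) x) *v four 1 e)"

definition gr_lagrangian :: "real \<Rightarrow> (real^4 \<Rightarrow> real^4^4) \<Rightarrow> real \<Rightarrow> real^3 \<Rightarrow> real^3 \<Rightarrow> real" where
  "gr_lagrangian c g t x e = sqrt (gr_radicand c g t x e)"

definition gr_momentum ::
  "real \<Rightarrow> (real^4 \<Rightarrow> real^4^4) \<Rightarrow> real \<Rightarrow> real \<Rightarrow> real^3 \<Rightarrow> real^3 \<Rightarrow> real^4" where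
  "gr_momentum c g M t x e =
     (M / gr_lagrangian c g t x e) *\<^sub>R (g (four (c * t) x) *v four 1 e)"

(* Spatial Lagrangian of the dispersion relation g^{ab} p_a p_b + \<xi> h(x,p) = M^2, to first order
   in the coupling \<xi>. *)
definition mdr_lagrangian ::
  "real \<Rightarrow> (real^4 \<Rightarrow> real^4^4) \<Rightarrow> (real^4 \<Rightarrow> real^4 \<Rightarrow> real) \<Rightarrow> real \<Rightarrow> real
    \<Rightarrow> real \<Rightarrow> real^3 \<Rightarrow> real^3 \<Rightarrow> real" where
  "mdr_lagrangian c g h \<xi> M t x e =
     gr_lagrangian c g t x e *
       (1 - \<xi> / (2 * M\<^sup>2) * h (four (c * t) x) (gr_momentum c g M t x e))"

definition d_t :: "(real \<Rightarrow> real^3 \<Rightarrow> real^3 \<Rightarrow> real) \<Rightarrow> real \<Rightarrow> real^3 \<Rightarrow> real^3 \<Rightarrow> real" where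
  "d_t F t x e = deriv (\<lambda>s. F s x e) t"

definition d_x :: "3 \<Rightarrow> (real \<Rightarrow> real^3 \<Rightarrow> real^3 \<Rightarrow> real) \<Rightarrow> real \<Rightarrow> real^3 \<Rightarrow> real^3 \<Rightarrow> real" where
  "d_x \<alpha> F t x e = deriv (\<lambda>s. F t (x + s *\<^sub>R axis \<alpha> 1) e) 0"

definition d_e :: "3 \<Rightarrow> (real \<Rightarrow> real^3 \<Rightarrow> real^3 \<Rightarrow> real) \<Rightarrow> real \<Rightarrow> real^3 \<Rightarrow> real^3 \<Rightarrow> real" where
  "d_e \<alpha> F t x e = deriv (\<lambda>s. F t x (e + s *\<^sub>R axis \<alpha> 1)) 0"

definition hessian_e :: "(real \<Rightarrow> real^3 \<Rightarrow> real^3 \<Rightarrow> real) \<Rightarrow> real \<Rightarrow> real^3 \<Rightarrow> real^3 \<Rightarrow> real^3^3" where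
  "hessian_e F t x e = (\<chi> \<alpha> \<beta>. d_e \<beta> (d_e \<alpha> F) t x e)"

(* a = d^2x/dt^2 solves the Euler-Lagrange equations of F at time t, position x, velocity v. *)
definition equation_of_motion ::
  "real \<Rightarrow> (real \<Rightarrow> real^3 \<Rightarrow> real^3 \<Rightarrow> real) \<Rightarrow> real \<Rightarrow> real^3 \<Rightarrow> real^3 \<Rightarrow> real^3 \<Rightarrow> bool" where
  "equation_of_motion c F t x v a \<longleftrightarrow> (let e = v /\<^sub>R c in
     \<forall>\<alpha>. (\<Sum>\<beta>\<in>UNIV. hessian_e F t x e $ \<alpha> $ \<beta> * a $ \<beta>) =
       c\<^sup>2 * d_x \<alpha> F t x e
       - c * (d_t (d_e \<alpha> F) t x e + (\<Sum>\<gamma>\<in>UNIV. v $ \<gamma> * d_x \<gamma> (d_e \<alpha> F) t x e)))"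

definition acceleration ::
  "real \<Rightarrow> (real^4 \<Rightarrow> real^4^4) \<Rightarrow> (real^4 \<Rightarrow> real^4 \<Rightarrow> real) \<Rightarrow> real \<Rightarrow> real
    \<Rightarrow> real \<Rightarrow> real^3 \<Rightarrow> real^3 \<Rightarrow> real^3" where
  "acceleration c g h \<xi> M t x v =
     (THE a. equation_of_motion c (mdr_lagrangian c g h \<xi> M) t x v a)"

(* States of motion (t, x, v) in the chart U that are timelike, have momentum in the domain D
   of h, and satisfy the standing assumption that the unperturbed Hessian is invertible. *)
definition states ::
  "real \<Rightarrow> (real^4) set \<Rightarrow> (real^4 \<Rightarrow> real^4^4) \<Rightarrow> ((real^4) \<times> (real^4)) set
    \<Rightarrow> (real \<times> (real^3) \<times> (real^3)) set" where
  "states c U g D = {(t, x, v). let e = v /\<^sub>R c; X = four (c * t) x in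
     X \<in> U \<and> 0 < gr_radicand c g t x e \<and> (\<forall>M>0. (X, gr_momentum c g M t x e) \<in> D) \<and>
     invertible (hessian_e (gr_lagrangian c g) t x e)}"

(* The spatial metric is an arbitrary positive definite matrix independent of the mass; this
   covers -g_\<alpha>\<beta>, -g_\<alpha>\<beta> + g_0\<alpha> g_0\<beta> / g_00 and the Euclidean metric wherever they are
   positive definite. *)
definition positive_definite :: "real^3^3 \<Rightarrow> bool" where
  "positive_definite A \<longleftrightarrow> transpose A = A \<and> (\<forall>w. w \<noteq> 0 \<longrightarrow> 0 < w \<bullet> (A *v w))"

definition metric_norm :: "real^3^3 \<Rightarrow> real^3 \<Rightarrow> real" where
  "metric_norm A w = sqrt (w \<bullet> (A *v w))"

definition eotvos_factor :: "real^3^3 \<Rightarrow> real^3 \<Rightarrow> real^3 \<Rightarrow> real" where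
  "eotvos_factor A a1 a2 = 2 * (metric_norm A (a1 - a2) / metric_norm A (a1 + a2))"

end

(* Homogeneity pulls the mass out of the perturbation: with p = M p1, the momentum p1 belonging to
   unit mass, the Lagrangian is \<ff> + k \<phi> for k = \<Xi>(M) M^(n-2) and \<phi> = - \<ff> h(x, p1) / 2, where
   neither \<ff> nor \<phi> involves M. The Euler-Lagrange equations are linear in the Lagrangian, so they
   become the linear system (A + k B) a = b + k d with A, B, b, d independent of M. Expanding its
   solution at k = 0 gives a_GR = A^-1 b and the first-order term k A^-1 (d - B a_GR). *)
theory Submission
  imports Defs
begin

text \<open>Two total operators shape the argument. \<open>deriv\<close> returns a value even where
  no derivative exists, so linearity of the Euler-Lagrange equations, which contain second
  derivatives, is available only where \<ff> and \<phi> are twice differentiable, and the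
  mass-scaling identity must hold on an open set around the state before it may be differentiated.
  \<open>THE\<close> is meaningful only where the linear system is uniquely solvable, which is known
  only for couplings near 0; hence every first-order claim is a limit s \<rightarrow> 0 with
  coupling s \<Xi>(M). The Eotvos factor contains the norm of a difference that vanishes at s = 0
  and therefore grows like |s|, which explains the one-sided limit in its expansion.\<close>

section \<open>Twice differentiable functions\<close>

text \<open>The second clause fixes the direction v and differentiates the real or vector valued map
  y \<mapsto> \<open>f' y v\<close>; this avoids a topology on the space of linear maps and is the
  form in which second partial derivatives arise.\<close>

definition twice_differentiable_on ::
  "'a::real_normed_vector set \<Rightarrow> ('a \<Rightarrow> 'b::real_normed_vector) \<Rightarrow> bool" where
  "twice_differentiable_on W f \<longleftrightarrow>
     (\<exists>f'. (\<forall>z\<in>W. (f has_derivative f' z) (at z)) \<and>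
           (\<forall>v. \<forall>z\<in>W. (\<lambda>y. f' y v) differentiable (at z)))"

lemma twice_differentiable_onI:
  assumes "\<And>z. z \<in> W \<Longrightarrow> (f has_derivative f' z) (at z)"
    and "\<And>v z. z \<in> W \<Longrightarrow> (\<lambda>y. f' y v) differentiable (at z)"
  shows "twice_differentiable_on W f"
  using assms unfolding twice_differentiable_on_def by blast

lemma twice_differentiable_onE:
  assumes "twice_differentiable_on W f"
  obtains f' where "\<And>z. z \<in> W \<Longrightarrow> (f has_derivative f' z) (at z)"
    and "\<And>v z. z \<in> W \<Longrightarrow> (\<lambda>y. f' y v) differentiable (at z)"
  using assms unfolding twice_differentiable_on_def by blast

lemma twice_differentiable_on_subset:
  "twice_differentiable_on W f \<Longrightarrow> V \<subseteq> W \<Longrightarrow> twice_differentiable_on V f"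
  unfolding twice_differentiable_on_def by blast

lemma twice_differentiable_on_imp_differentiable:
  "twice_differentiable_on W f \<Longrightarrow> z \<in> W \<Longrightarrow> f differentiable (at z)"
  by (meson differentiable_def twice_differentiable_onE)

lemma twice_differentiable_on_imp_continuous_on:
  "twice_differentiable_on W f \<Longrightarrow> continuous_on W f"
  by (meson continuous_at_imp_continuous_on differentiable_imp_continuous_within
      twice_differentiable_on_imp_differentiable)

lemma differentiable_transform_open:
  assumes "f differentiable (at z)" "open W" "z \<in> W" "\<And>y. y \<in> W \<Longrightarrow> f y = g y"
  shows "g differentiable (at z)"
  using assms unfolding differentiable_def by (meson has_derivative_transform_within_open)

text \<open>By uniqueness of derivatives the witness \<open>f'\<close> coincides with
  \<open>frechet_derivative\<close> throughout the open set W, so differentiability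
  transfers.\<close>

lemma twice_differentiable_on_frechet_derivative:
  assumes "twice_differentiable_on W f" "open W" "z \<in> W"
  shows "(\<lambda>y. frechet_derivative f (at y) v) differentiable (at z)"
proof -
  obtain f' where f': "\<And>z. z \<in> W \<Longrightarrow> (f has_derivative f' z) (at z)"
    and d: "\<And>v z. z \<in> W \<Longrightarrow> (\<lambda>y. f' y v) differentiable (at z)"
    using assms(1) by (rule twice_differentiable_onE) blast
  show ?thesis
    using d[OF assms(3)] assms(2,3)
    by (rule differentiable_transform_open) (simp add: frechet_derivative_at[OF f', symmetric])
qed

lemma smooth_on_imp_twice_differentiable_on:
  assumes "smooth_on W f"
  shows "twice_differentiable_on W f"
proof (rule twice_differentiable_onI)
  have d: "differentiable_of_order (Suc (Suc 0)) W f"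
    using assms unfolding smooth_on_def by blast
  show "(f has_derivative frechet_derivative f (at z)) (at z)" if "z \<in> W" for z
    using d that by (simp add: frechet_derivative_works[symmetric])
  show "(\<lambda>y. frechet_derivative f (at y) v) differentiable (at z)" if "z \<in> W" for v z
    using d that by simp
qed

lemma differentiable_bounded_linear:
  assumes "bounded_linear L" "f differentiable F"
  shows "(\<lambda>z. L (f z)) differentiable F"
  using assms bounded_linear.has_derivative unfolding differentiable_def by blast

lemma differentiable_bounded_bilinear:
  assumes "bounded_bilinear B" "f differentiable (at z)" "g differentiable (at z)"
  shows "(\<lambda>z. B (f z) (g z)) differentiable (at z)"
  using assms bounded_bilinear.FDERIV unfolding differentiable_def by blast

lemma twice_differentiable_on_const: "twice_differentiable_on W (\<lambda>z. c)"
  by (rule twice_differentiable_onI[where f' = "\<lambda>z v. 0"]) auto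

lemma twice_differentiable_on_ident: "twice_differentiable_on W (\<lambda>z. z)"
  by (rule twice_differentiable_onI[where f' = "\<lambda>z v. v"]) auto

lemma twice_differentiable_on_Pair:
  assumes "twice_differentiable_on W f" "twice_differentiable_on W g"
  shows "twice_differentiable_on W (\<lambda>z. (f z, g z))"
  using assms
proof (elim twice_differentiable_onE)
  fix f' g'
  assume f': "\<And>z. z \<in> W \<Longrightarrow> (f has_derivative f' z) (at z)"
    "\<And>v z. z \<in> W \<Longrightarrow> (\<lambda>y. f' y v) differentiable (at z)"
  assume g': "\<And>z. z \<in> W \<Longrightarrow> (g has_derivative g' z) (at z)"
    "\<And>v z. z \<in> W \<Longrightarrow> (\<lambda>y. g' y v) differentiable (at z)"
  show ?thesis
  proof (rule twice_differentiable_onI[OF has_derivative_Pair[OF f'(1) g'(1)]])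
    fix v z assume z: "z \<in> W"
    obtain D E where "((\<lambda>y. f' y v) has_derivative D) (at z)" "((\<lambda>y. g' y v) has_derivative E) (at z)"
      using f'(2)[OF z] g'(2)[OF z] unfolding differentiable_def by blast
    from has_derivative_Pair[OF this] show "(\<lambda>y. (f' y v, g' y v)) differentiable (at z)"
      unfolding differentiable_def by blast
  qed
qed

lemma twice_differentiable_on_bounded_linear:
  assumes "bounded_linear L" "twice_differentiable_on W f"
  shows "twice_differentiable_on W (\<lambda>z. L (f z))"
  using assms(2)
  by (elim twice_differentiable_onE, intro twice_differentiable_onI)
     (rule bounded_linear.has_derivative[OF assms(1)] differentiable_bounded_linear[OF assms(1)];
      blast)+

lemma twice_differentiable_on_bounded_bilinear:
  assumes B: "bounded_bilinear B"
    and "twice_differentiable_on W f" "twice_differentiable_on W g"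
  shows "twice_differentiable_on W (\<lambda>z. B (f z) (g z))"
  using assms(2,3)
proof (elim twice_differentiable_onE)
  fix f' g'
  assume f': "\<And>z. z \<in> W \<Longrightarrow> (f has_derivative f' z) (at z)"
    "\<And>v z. z \<in> W \<Longrightarrow> (\<lambda>y. f' y v) differentiable (at z)"
  assume g': "\<And>z. z \<in> W \<Longrightarrow> (g has_derivative g' z) (at z)"
    "\<And>v z. z \<in> W \<Longrightarrow> (\<lambda>y. g' y v) differentiable (at z)"
  have "f differentiable (at z)" "g differentiable (at z)" if "z \<in> W" for z
    using f'(1) g'(1) that unfolding differentiable_def by blast+
  then show ?thesis
    by (intro twice_differentiable_onI[OF bounded_bilinear.FDERIV[OF B f'(1) g'(1)]]
        differentiable_add differentiable_bounded_bilinear[OF B] f'(2) g'(2))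
qed

lemma twice_differentiable_on_compose:
  fixes f :: "'b::euclidean_space \<Rightarrow> 'c::real_normed_vector"
  assumes f: "twice_differentiable_on V f" and g: "twice_differentiable_on W g"
    and W: "open W" and sub: "g ` W \<subseteq> V"
  shows "twice_differentiable_on W (\<lambda>z. f (g z))"
proof -
  obtain f' where f': "\<And>z. z \<in> V \<Longrightarrow> (f has_derivative f' z) (at z)"
    "\<And>v z. z \<in> V \<Longrightarrow> (\<lambda>y. f' y v) differentiable (at z)"
    using f by (rule twice_differentiable_onE) blast
  obtain g' where g': "\<And>z. z \<in> W \<Longrightarrow> (g has_derivative g' z) (at z)"
    "\<And>v z. z \<in> W \<Longrightarrow> (\<lambda>y. g' y v) differentiable (at z)"
    using g by (rule twice_differentiable_onE) blast
  show ?thesis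
  proof (rule twice_differentiable_onI)
    fix z assume z: "z \<in> W"
    show "((\<lambda>z. f (g z)) has_derivative (\<lambda>v. f' (g z) (g' z v))) (at z)"
      using diff_chain_at[OF g'(1)[OF z] f'(1)] z sub by (auto simp: o_def)
    fix v
    \<comment> \<open>In the chain rule the direction \<open>g' y v\<close> moves with y, whereas
      differentiability of \<open>f'\<close> is known only for fixed directions. Expanding in the
      finite basis leaves products of differentiable coefficients with fixed-direction
      derivatives.\<close>
    have expand: "(\<Sum>b\<in>Basis. (g' y v \<bullet> b) *\<^sub>R f' (g y) b) = f' (g y) (g' y v)" if "y \<in> W" for y
    proof -
      have "linear (f' (g y))"
        using f'(1) sub that has_derivative_linear by blast
      then have "f' (g y) (\<Sum>b\<in>Basis. (g' y v \<bullet> b) *\<^sub>R b) = (\<Sum>b\<in>Basis. (g' y v \<bullet> b) *\<^sub>R f' (g y) b)"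
        by (simp add: linear_sum linear_cmul)
      then show ?thesis by (simp add: euclidean_representation)
    qed
    have "(\<lambda>y. \<Sum>b\<in>Basis. (g' y v \<bullet> b) *\<^sub>R f' (g y) b) differentiable (at z)"
    proof (intro differentiable_sum differentiable_scaleR ballI)
      fix b
      show "(\<lambda>y. g' y v \<bullet> b) differentiable (at z)"
        by (rule differentiable_bounded_linear[OF bounded_linear_inner_left g'(2)[OF z]])
      have "g differentiable (at z)" using g'(1)[OF z] unfolding differentiable_def by blast
      then show "(\<lambda>y. f' (g y) b) differentiable (at z)"
        using differentiable_chain_at[of g z "\<lambda>y. f' y b"] f'(2) z sub by (auto simp: o_def)
    qed simp
    then show "(\<lambda>y. f' (g y) (g' y v)) differentiable (at z)"
      using W z expand by (rule differentiable_transform_open)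
  qed
qed

lemma twice_differentiable_on_inverse: "twice_differentiable_on {0<..} (inverse :: real \<Rightarrow> real)"
proof (rule twice_differentiable_onI[where f' = "\<lambda>x v. - (inverse x * v * inverse x)"])
  fix x :: real assume "x \<in> {0<..}"
  then show "(inverse has_derivative (\<lambda>v. - (inverse x * v * inverse x))) (at x)"
    by (auto intro!: derivative_eq_intros)
qed auto

lemma differentiable_sqrt: "0 < x \<Longrightarrow> sqrt differentiable (at x)"
  using DERIV_real_sqrt[of x] real_differentiable_def by blast

lemma twice_differentiable_on_sqrt: "twice_differentiable_on {0<..} sqrt"
proof (rule twice_differentiable_onI[where f' = "\<lambda>x. (*) (inverse (sqrt x) / 2)"])
  fix x v :: real assume x: "x \<in> {0<..}"
  show "(sqrt has_derivative (*) (inverse (sqrt x) / 2)) (at x)"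
    using DERIV_real_sqrt[of x] x by (simp add: has_field_derivative_def)
  show "(\<lambda>y. inverse (sqrt y) / 2 * v) differentiable (at x)"
    using x by (intro differentiable_mult differentiable_divide differentiable_inverse
        differentiable_sqrt differentiable_const) auto
qed

section \<open>Perturbed linear systems\<close>

lemma linear_system_iff:
  fixes A :: "real^'n^'n"
  assumes "invertible A"
  shows "A *v a = b \<longleftrightarrow> a = matrix_inv A *v b"
proof -
  have "A ** matrix_inv A = mat 1" "matrix_inv A ** A = mat 1"
    using assms someI_ex[of "\<lambda>B. A ** B = mat 1 \<and> B ** A = mat 1"]
    unfolding invertible_def matrix_inv_def by auto
  then show ?thesis
    by (metis matrix_vector_mul_assoc matrix_vector_mul_lid)
qed

text \<open>Serves to treat both first-order expansions, that of the perturbed solution and that of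
  the Eotvos factor, as limits of difference quotients.\<close>

lemma has_vector_derivative_iff_quotient:
  fixes f :: "real \<Rightarrow> 'a::real_normed_vector"
  shows "(f has_vector_derivative D) (at x) \<longleftrightarrow>
    ((\<lambda>y. (f y - f x) /\<^sub>R (y - x)) \<longlongrightarrow> D) (at x)"
proof -
  have eq: "norm (f y - f x - (y - x) *\<^sub>R D) / norm (y - x) =
      norm ((f y - f x) /\<^sub>R (y - x) - D)" if "y \<noteq> x" for y
  proof -
    have "(f y - f x) /\<^sub>R (y - x) - D = (f y - f x - (y - x) *\<^sub>R D) /\<^sub>R (y - x)"
      using that by (simp add: scaleR_diff_right)
    then show ?thesis by (simp add: divide_inverse mult.commute)
  qed
  have "(f has_vector_derivative D) (at x) \<longleftrightarrow>
      ((\<lambda>y. norm (f y - f x - (y - x) *\<^sub>R D) / norm (y - x)) \<longlongrightarrow> 0) (at x)"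
    by (simp add: has_vector_derivative_def has_derivative_iff_norm bounded_linear_scaleR_left)
  also have "\<dots> \<longleftrightarrow> ((\<lambda>y. norm ((f y - f x) /\<^sub>R (y - x) - D)) \<longlongrightarrow> 0) (at x)"
    by (intro filterlim_cong refl) (auto simp: eq[unfolded real_norm_def] eventually_at_filter)
  also have "\<dots> \<longleftrightarrow> ((\<lambda>y. (f y - f x) /\<^sub>R (y - x)) \<longlongrightarrow> D) (at x)"
    by (simp add: tendsto_norm_zero_iff LIM_zero_iff)
  finally show ?thesis .
qed

text \<open>Instead of differentiating an inverse matrix, the proof bootstraps from the identity
  a(s) = a0 + s C (d - B a(s)) with C the inverse of A: it yields first boundedness of a near 0,
  then continuity at 0, then the derivative.\<close>

lemma linear_system_perturbation:
  fixes A B :: "real^'n^'n" and b d :: "real^'n"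
  assumes A: "invertible A"
  defines "a0 \<equiv> matrix_inv A *v b"
  shows "\<forall>\<^sub>F s in nhds 0. \<exists>!a. (A + s *\<^sub>R B) *v a = b + s *\<^sub>R d"
    and "((\<lambda>s. THE a. (A + s *\<^sub>R B) *v a = b + s *\<^sub>R d) has_vector_derivative
           matrix_inv A *v (d - B *v a0)) (at 0)"
proof -
  define C where "C = matrix_inv A"
  define a where "a s = (THE a. (A + s *\<^sub>R B) *v a = b + s *\<^sub>R d)" for s
  \<comment> \<open>The determinant is a polynomial in the entries, hence continuous in s and
    nonzero near 0.\<close>
  have "((\<lambda>s. det (A + s *\<^sub>R B)) \<longlongrightarrow> det (A + 0 *\<^sub>R B)) (nhds 0)"
    unfolding det_def by (simp only: vector_add_component vector_scaleR_component)
      (intro tendsto_intros filterlim_ident)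
  moreover have "det (A + 0 *\<^sub>R B) \<noteq> 0" using A by (simp add: invertible_det_nz)
  ultimately have "\<forall>\<^sub>F s in nhds 0. det (A + s *\<^sub>R B) \<noteq> 0"
    by (rule tendsto_imp_eventually_ne)
  then show ev: "\<forall>\<^sub>F s in nhds 0. \<exists>!a. (A + s *\<^sub>R B) *v a = b + s *\<^sub>R d"
    by (rule eventually_mono) (simp add: linear_system_iff invertible_det_nz)
  have a: "a s = a0 + s *\<^sub>R (C *v (d - B *v a s))"
    if "\<exists>!a. (A + s *\<^sub>R B) *v a = b + s *\<^sub>R d" for s
  proof -
    have "(A + s *\<^sub>R B) *v a s = b + s *\<^sub>R d"
      unfolding a_def using that by (rule theI')
    then have "A *v a s = b + s *\<^sub>R (d - B *v a s)"
      by (simp add: algebra_simps scaleR_matrix_vector_assoc)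
    then have "a s = C *v (b + s *\<^sub>R (d - B *v a s))"
      using linear_system_iff[OF A] C_def by simp
    then show ?thesis
      by (simp add: matrix_vector_right_distrib matrix_vector_mult_scaleR a0_def C_def)
  qed
  \<comment> \<open>The filter \<open>nhds 0\<close>, unlike \<open>at 0\<close>, includes the point
    s = 0 itself.\<close>
  have a_0: "a 0 = a0" using a[OF eventually_nhds_x_imp_x[OF ev]] by simp
  obtain K where K: "K > 0" "\<And>w. norm (C *v (B *v w)) \<le> norm w * K"
    using bounded_linear.pos_bounded[OF bounded_linear_compose[OF
        matrix_vector_mul_bounded_linear[of C] matrix_vector_mul_bounded_linear[of B]]]
    by blast
  \<comment> \<open>The factor 2 comes from absorbing half of |a(s)| into the left-hand side; the
    bound |s| < 1 used below lets |C d| stand without its factor |s|.\<close>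
  define K' where "K' = 2 * (norm a0 + norm (C *v d))"
  \<comment> \<open>The identity for a(s) bounds |a(s)| by a constant plus |s| K |a(s)|, and |s| K is at most 1/2.\<close>
  have bound: "\<forall>\<^sub>F s in at 0. norm (a s) \<le> K'"
  proof -
    have "\<forall>\<^sub>F s in nhds (0::real). \<bar>s\<bar> < min 1 (1 / (2 * K))"
      using K(1) eventually_nhds_metric[of _ "0::real"]
      by (auto simp: dist_real_def intro!: exI[of _ "min 1 (1 / (2 * K))"])
    with ev have "\<forall>\<^sub>F s in nhds 0. norm (a s) \<le> K'"
    proof eventually_elim
      case (elim s)
      have "norm (a s) = norm (a0 + s *\<^sub>R (C *v d) - s *\<^sub>R (C *v (B *v a s)))"
        by (subst a[OF elim(1)]) (simp add: algebra_simps matrix_vector_mult_diff_distrib)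
      also have "\<dots> \<le> norm a0 + \<bar>s\<bar> * norm (C *v d) + \<bar>s\<bar> * norm (C *v (B *v a s))"
        by (smt (verit) norm_scaleR norm_triangle_ineq norm_triangle_ineq4)
      also have "\<bar>s\<bar> * norm (C *v d) \<le> norm (C *v d)"
        using elim(2) by (simp add: mult_left_le_one_le)
      also have "\<bar>s\<bar> * norm (C *v (B *v a s)) \<le> \<bar>s\<bar> * (norm (a s) * K)"
        using K(2) by (intro mult_left_mono) auto
      also have "\<dots> = (\<bar>s\<bar> * K) * norm (a s)" by simp
      also have "\<dots> \<le> (1 / 2) * norm (a s)"
        using elim(2) K(1) by (intro mult_right_mono) (auto simp: field_simps)
      finally show ?case by (simp add: K'_def)
    qed
    then show ?thesis by (simp add: eventually_nhds_conv_at)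
  qed
  have ev': "\<forall>\<^sub>F s in at 0. \<exists>!a. (A + s *\<^sub>R B) *v a = b + s *\<^sub>R d"
    using ev by (simp add: eventually_nhds_conv_at)
  \<comment> \<open>The identity for a(s) gives the difference quotient exactly, so
    differentiability at 0 reduces to continuity of a at 0.\<close>
  have quot: "\<forall>\<^sub>F s in at 0. C *v (d - B *v a s) = (a s - a0) /\<^sub>R s"
    using ev' eventually_neq_at_within[of 0]
  proof eventually_elim
    case (elim s)
    then show ?case using a[OF elim(1)] by (metis add_diff_cancel_left' scaleR_scaleR
          left_inverse scaleR_one)
  qed
  \<comment> \<open>A bounded quantity times s tends to 0; this is where boundedness becomes
    continuity.\<close>
  have "((\<lambda>s. s *\<^sub>R (C *v (d - B *v a s))) \<longlongrightarrow> 0) (at 0)"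
  proof (rule tendsto_0_le)
    show "((\<lambda>s::real. s * (norm (C *v d) + K' * K)) \<longlongrightarrow> 0) (at 0)"
      by (auto intro!: tendsto_eq_intros)
    show "\<forall>\<^sub>F s in at 0. norm (s *\<^sub>R (C *v (d - B *v a s))) \<le> norm (s * (norm (C *v d) + K' * K)) * 1"
      using bound
    proof eventually_elim
      case (elim s)
      have "norm (C *v (d - B *v a s)) \<le> norm (C *v d) + norm (C *v (B *v a s))"
        by (simp add: matrix_vector_mult_diff_distrib norm_triangle_ineq4)
      also have "norm (C *v (B *v a s)) \<le> norm (a s) * K" by (rule K(2))
      also have "\<dots> \<le> K' * K" using elim K(1) by simp
      finally have "norm (C *v (d - B *v a s)) \<le> \<bar>norm (C *v d) + K' * K\<bar>" by simp
      then show ?case by (simp add: abs_mult mult_left_mono)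
    qed
  qed
  then have "((\<lambda>s. a0 + s *\<^sub>R (C *v (d - B *v a s))) \<longlongrightarrow> a0 + 0) (at 0)"
    by (intro tendsto_add tendsto_const)
  moreover have "\<forall>\<^sub>F s in at 0. a0 + s *\<^sub>R (C *v (d - B *v a s)) = a s"
    using ev' by eventually_elim (use a in metis)
  ultimately have lim: "(a \<longlongrightarrow> a0) (at 0)"
    using tendsto_cong by fastforce
  have "((\<lambda>s. C *v (d - B *v a s)) \<longlongrightarrow> C *v (d - B *v a0)) (at 0)"
    by (intro bounded_linear.tendsto[OF matrix_vector_mul_bounded_linear] tendsto_diff
        tendsto_const lim)
  then have "((\<lambda>s. (a s - a0) /\<^sub>R s) \<longlongrightarrow> C *v (d - B *v a0)) (at 0)"
    using tendsto_cong[OF quot] by simp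
  then have "(a has_vector_derivative C *v (d - B *v a0)) (at 0)"
    by (simp add: has_vector_derivative_iff_quotient a_0)
  then show "((\<lambda>s. THE a. (A + s *\<^sub>R B) *v a = b + s *\<^sub>R d) has_vector_derivative
           matrix_inv A *v (d - B *v a0)) (at 0)"
    unfolding a_def C_def .
qed

section \<open>The Eotvos factor\<close>

lemma metric_norm_scaleR: "metric_norm P (r *\<^sub>R w) = \<bar>r\<bar> * metric_norm P w"
proof -
  have "(r *\<^sub>R w) \<bullet> (P *v (r *\<^sub>R w)) = r\<^sup>2 * (w \<bullet> (P *v w))"
    by (simp add: matrix_vector_mult_scaleR power2_eq_square)
  then show ?thesis by (simp add: metric_norm_def real_sqrt_mult)
qed

lemma tendsto_metric_norm:
  assumes "(f \<longlongrightarrow> a) F"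
  shows "((\<lambda>s. metric_norm P (f s)) \<longlongrightarrow> metric_norm P a) F"
  unfolding metric_norm_def
  by (intro tendsto_intros bounded_linear.tendsto[OF matrix_vector_mul_bounded_linear] assms)

text \<open>The common value \<open>a0\<close> cancels in the difference, so (a1 - a2) / s tends to
  (k1 - k2) w, while a1 + a2 tends to 2 \<open>a0\<close>; this 2 cancels the 2 in the definition of
  the Eotvos factor.\<close>

lemma eotvos_factor_first_order:
  assumes P: "positive_definite P"
    and a1: "(a1 has_vector_derivative k1 *\<^sub>R w) (at 0)" "a1 0 = a0"
    and a2: "(a2 has_vector_derivative k2 *\<^sub>R w) (at 0)" "a2 0 = a0"
    and a0: "a0 \<noteq> 0"
  shows "(\<lambda>s. eotvos_factor P (a1 s) (a2 s)
      - s * (\<bar>k1 - k2\<bar> * (metric_norm P w / metric_norm P a0))) \<in> o[at_right 0](\<lambda>s. s)"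
proof (rule smalloI_tendsto)
  \<comment> \<open>Keeps the limit of the denominator away from 0.\<close>
  have pos: "metric_norm P a0 > 0"
    using P a0 by (simp add: positive_definite_def metric_norm_def)
  let ?q = "\<lambda>s. metric_norm P ((a1 s - a2 s) /\<^sub>R s) / metric_norm P (a1 s + a2 s)"
  have "((\<lambda>s. (a1 s - a0) /\<^sub>R s - (a2 s - a0) /\<^sub>R s) \<longlongrightarrow> k1 *\<^sub>R w - k2 *\<^sub>R w) (at 0)"
    using a1 a2 by (intro tendsto_diff) (simp_all add: has_vector_derivative_iff_quotient)
  then have "((\<lambda>s. (a1 s - a2 s) /\<^sub>R s) \<longlongrightarrow> (k1 - k2) *\<^sub>R w) (at 0)"
    by (simp add: algebra_simps)
  then have num: "((\<lambda>s. metric_norm P ((a1 s - a2 s) /\<^sub>R s)) \<longlongrightarrow> \<bar>k1 - k2\<bar> * metric_norm P w)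
      (at 0)"
    using tendsto_metric_norm metric_norm_scaleR by metis
  have "(a1 \<longlongrightarrow> a0) (at 0)" "(a2 \<longlongrightarrow> a0) (at 0)"
    using has_vector_derivative_continuous[OF a1(1)] has_vector_derivative_continuous[OF a2(1)] a1 a2
    by (simp_all add: continuous_at isCont_def)
  then have "((\<lambda>s. a1 s + a2 s) \<longlongrightarrow> 2 *\<^sub>R a0) (at 0)"
    unfolding scaleR_2 by (rule tendsto_add)
  then have den: "((\<lambda>s. metric_norm P (a1 s + a2 s)) \<longlongrightarrow> 2 * metric_norm P a0) (at 0)"
    using tendsto_metric_norm[of _ "2 *\<^sub>R a0"] by (simp add: metric_norm_scaleR)
  have "((\<lambda>s. 2 * ?q s - \<bar>k1 - k2\<bar> * (metric_norm P w / metric_norm P a0)) \<longlongrightarrow>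
      2 * ((\<bar>k1 - k2\<bar> * metric_norm P w) / (2 * metric_norm P a0))
        - \<bar>k1 - k2\<bar> * (metric_norm P w / metric_norm P a0)) (at 0)"
    using pos by (intro tendsto_intros num den) simp
  from tendsto_mono[OF at_le[OF subset_UNIV] this] have lim: "((\<lambda>s. 2 * ?q s - \<bar>k1 - k2\<bar> * (metric_norm P w / metric_norm P a0)) \<longlongrightarrow> 0) (at_right 0)"
    using pos by simp
  \<comment> \<open>Positivity of s is what allows 1 / s to pass through the norm without an
    absolute value.\<close>
  have "(eotvos_factor P (a1 s) (a2 s) - s * (\<bar>k1 - k2\<bar> * (metric_norm P w / metric_norm P a0))) / s
      = 2 * ?q s - \<bar>k1 - k2\<bar> * (metric_norm P w / metric_norm P a0)" if "s > 0" for s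
    using that by (simp add: eotvos_factor_def metric_norm_scaleR divide_simps)
  then have "\<forall>\<^sub>F s in at_right 0.
      2 * ?q s - \<bar>k1 - k2\<bar> * (metric_norm P w / metric_norm P a0) =
      (eotvos_factor P (a1 s) (a2 s) - s * (\<bar>k1 - k2\<bar> * (metric_norm P w / metric_norm P a0))) / s"
    by (simp add: eventually_at_filter)
  then show "((\<lambda>s. (eotvos_factor P (a1 s) (a2 s)
      - s * (\<bar>k1 - k2\<bar> * (metric_norm P w / metric_norm P a0))) / s) \<longlongrightarrow> 0) (at_right 0)"
    using lim tendsto_cong by fast
qed (simp add: eventually_at_filter)

section \<open>Linearity of the Euler-Lagrange equations in the Lagrangian\<close>

abbreviation uncurry3 :: "('a \<Rightarrow> 'b \<Rightarrow> 'c \<Rightarrow> 'd) \<Rightarrow> 'a \<times> 'b \<times> 'c \<Rightarrow> 'd" where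
  "uncurry3 F \<equiv> (\<lambda>z. F (fst z) (fst (snd z)) (snd (snd z)))"

text \<open>One interface for \<open>d_t\<close>, \<open>d_x\<close> and \<open>d_e\<close>:
  evaluation of the Frechet derivative at a vector u. The same u serves all functions and points,
  which makes the operator linear; nothing is demanded where F is not differentiable.\<close>

definition directional ::
  "((real \<Rightarrow> real^3 \<Rightarrow> real^3 \<Rightarrow> real) \<Rightarrow> real \<Rightarrow> real^3 \<Rightarrow> real^3 \<Rightarrow> real) \<Rightarrow> bool" where
  "directional d \<longleftrightarrow> (\<exists>u. \<forall>F F' t x e.
     (uncurry3 F has_derivative F') (at (t, x, e)) \<longrightarrow> d F t x e = F' u)"

lemma deriv_along_line:
  fixes f :: "'a::real_normed_vector \<Rightarrow> real"
  assumes f: "(f has_derivative f') (at (\<sigma> s))"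
    and \<sigma>: "(\<sigma> has_derivative (\<lambda>r. r *\<^sub>R u)) (at s)"
  shows "deriv (\<lambda>r. f (\<sigma> r)) s = f' u"
proof (rule DERIV_imp_deriv)
  have "((\<lambda>r. f (\<sigma> r)) has_derivative (\<lambda>r. f' (r *\<^sub>R u))) (at s)"
    using diff_chain_at[OF \<sigma> f] by (simp add: o_def)
  moreover have "f' (r *\<^sub>R u) = f' u * r" for r
    using linear_cmul[OF has_derivative_linear[OF f]] by simp
  ultimately show "((\<lambda>r. f (\<sigma> r)) has_field_derivative f' u) (at s)"
    by (simp add: has_field_derivative_def)
qed

lemma directional_d_t: "directional d_t"
  unfolding directional_def d_t_def
proof (intro exI allI impI)
  fix F :: "real \<Rightarrow> real^3 \<Rightarrow> real^3 \<Rightarrow> real" and F' t x e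
  assume "(uncurry3 F has_derivative F') (at (t, x, e))"
  moreover have "((\<lambda>s. (s, x, e)) has_derivative (\<lambda>r. r *\<^sub>R (1, 0, 0))) (at t)"
    by (auto intro!: derivative_eq_intros simp: zero_prod_def)
  ultimately show "deriv (\<lambda>s. F s x e) t = F' (1, 0, 0)"
    using deriv_along_line[of "uncurry3 F" F' "\<lambda>s. (s, x, e)" t "(1, 0, 0)"]
    by simp
qed

lemma directional_d_x: "directional (d_x \<alpha>)"
  unfolding directional_def d_x_def
proof (intro exI allI impI)
  fix F :: "real \<Rightarrow> real^3 \<Rightarrow> real^3 \<Rightarrow> real" and F' t x e
  assume "(uncurry3 F has_derivative F') (at (t, x, e))"
  moreover have "((\<lambda>s. (t, x + s *\<^sub>R axis \<alpha> 1, e)) has_derivative (\<lambda>r. r *\<^sub>R (0, axis \<alpha> 1, 0))) (at 0)"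
    by (auto intro!: derivative_eq_intros simp: zero_prod_def)
  ultimately show "deriv (\<lambda>s. F t (x + s *\<^sub>R axis \<alpha> 1) e) 0 = F' (0, axis \<alpha> 1, 0)"
    using deriv_along_line[of "uncurry3 F" F' "\<lambda>s. (t, x + s *\<^sub>R axis \<alpha> 1, e)" 0 "(0, axis \<alpha> 1, 0)"]
    by simp
qed

lemma directional_d_e: "directional (d_e \<alpha>)"
  unfolding directional_def d_e_def
proof (intro exI allI impI)
  fix F :: "real \<Rightarrow> real^3 \<Rightarrow> real^3 \<Rightarrow> real" and F' t x e
  assume "(uncurry3 F has_derivative F') (at (t, x, e))"
  moreover have "((\<lambda>s. (t, x, e + s *\<^sub>R axis \<alpha> 1)) has_derivative (\<lambda>r. r *\<^sub>R (0, 0, axis \<alpha> 1))) (at 0)"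
    by (auto intro!: derivative_eq_intros simp: zero_prod_def)
  ultimately show "deriv (\<lambda>s. F t x (e + s *\<^sub>R axis \<alpha> 1)) 0 = F' (0, 0, axis \<alpha> 1)"
    using deriv_along_line[of "uncurry3 F" F' "\<lambda>s. (t, x, e + s *\<^sub>R axis \<alpha> 1)" 0 "(0, 0, axis \<alpha> 1)"]
    by simp
qed

text \<open>Derivatives are local, so the decomposition of H is required only on an open W. For the
  dispersion relation it is established only where the momentum lies in the domain of h.\<close>

lemma directional_linear:
  assumes d: "directional d" and W: "open W" "(t, x, e) \<in> W"
    and F: "uncurry3 F differentiable (at (t, x, e))"
    and G: "uncurry3 G differentiable (at (t, x, e))"
    and H: "\<And>t x e. (t, x, e) \<in> W \<Longrightarrow> H t x e = F t x e + k * G t x e"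
  shows "d H t x e = d F t x e + k * d G t x e"
proof -
  obtain u where u: "\<And>F F' t x e. (uncurry3 F has_derivative F') (at (t, x, e)) \<Longrightarrow> d F t x e = F' u"
    using d unfolding directional_def by blast
  obtain F' G' where F': "(uncurry3 F has_derivative F') (at (t, x, e))"
    and G': "(uncurry3 G has_derivative G') (at (t, x, e))"
    using F G unfolding differentiable_def by blast
  have "(uncurry3 H has_derivative (\<lambda>v. F' v + k * G' v)) (at (t, x, e))"
  proof (rule has_derivative_transform_within_open[OF _ W])
    show "((\<lambda>z. uncurry3 F z + k * uncurry3 G z) has_derivative (\<lambda>v. F' v + k * G' v)) (at (t, x, e))"
      by (intro has_derivative_add has_derivative_mult_right F' G')
  qed (simp add: H split: prod.splits)
  then show ?thesis
    using u[OF F'] u[OF G'] u by fastforce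
qed

text \<open>On W the function \<open>d F\<close> is the Frechet derivative of F in the fixed
  direction u, to which the second clause of twice differentiability applies.\<close>

lemma directional_differentiable:
  assumes d: "directional d" and W: "open W" "z \<in> W" and F: "twice_differentiable_on W (uncurry3 F)"
  shows "uncurry3 (d F) differentiable (at z)"
proof -
  obtain u where u: "\<And>F F' t x e. (uncurry3 F has_derivative F') (at (t, x, e)) \<Longrightarrow> d F t x e = F' u"
    using d unfolding directional_def by blast
  have "frechet_derivative (uncurry3 F) (at y) u = uncurry3 (d F) y" if "y \<in> W" for y
    using u[of F "frechet_derivative (uncurry3 F) (at y)" "fst y" "fst (snd y)" "snd (snd y)"]
      twice_differentiable_on_imp_differentiable[OF F that]
    by (simp add: frechet_derivative_works[symmetric])
  then show ?thesis
    by (rule differentiable_transform_open[OF twice_differentiable_on_frechet_derivative[OF F W] W])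
qed

text \<open>Linearity of the inner operator holds at every point of W, which provides the
  decomposition of \<open>d H\<close> on an open set that the outer operator needs.\<close>

lemma directional_linear2:
  assumes d: "directional d" "directional d'" and W: "open W" "(t, x, e) \<in> W"
    and F: "twice_differentiable_on W (uncurry3 F)"
    and G: "twice_differentiable_on W (uncurry3 G)"
    and H: "\<And>t x e. (t, x, e) \<in> W \<Longrightarrow> H t x e = F t x e + k * G t x e"
  shows "d' (d H) t x e = d' (d F) t x e + k * d' (d G) t x e"
  using d(2) W
proof (rule directional_linear)
  show "uncurry3 (d F) differentiable (at (t, x, e))" "uncurry3 (d G) differentiable (at (t, x, e))"
    by (rule directional_differentiable[OF d(1) W] F G)+
  show "d H t x e = d F t x e + k * d G t x e" if "(t, x, e) \<in> W" for t x e
    using d(1) W(1) that twice_differentiable_on_imp_differentiable[OF F that]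
      twice_differentiable_on_imp_differentiable[OF G that] H
    by (rule directional_linear)
qed

text \<open>The right-hand side of the Euler-Lagrange equations collected into a vector, so that
  they read Hessian times acceleration equals force.\<close>

definition force ::
  "real \<Rightarrow> (real \<Rightarrow> real^3 \<Rightarrow> real^3 \<Rightarrow> real) \<Rightarrow> real \<Rightarrow> real^3 \<Rightarrow> real^3 \<Rightarrow> real^3" where
  "force c F t x v = (\<chi> \<alpha>. c\<^sup>2 * d_x \<alpha> F t x (v /\<^sub>R c)
     - c * (d_t (d_e \<alpha> F) t x (v /\<^sub>R c) + (\<Sum>\<gamma>\<in>UNIV. v $ \<gamma> * d_x \<gamma> (d_e \<alpha> F) t x (v /\<^sub>R c))))"

lemma equation_of_motion_iff:
  "equation_of_motion c F t x v a \<longleftrightarrow> hessian_e F t x (v /\<^sub>R c) *v a = force c F t x v"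
  by (simp add: equation_of_motion_def force_def Let_def vec_eq_iff matrix_vector_mult_def)

text \<open>Every entry is a combination, with coefficients free of the Lagrangian, of one
  \<open>d_x\<close> or of a second derivative whose inner operator is \<open>d_e\<close>.\<close>

lemma hessian_force_linear:
  assumes W: "open W" "(t, x, v /\<^sub>R c) \<in> W"
    and F: "twice_differentiable_on W (uncurry3 F)"
    and G: "twice_differentiable_on W (uncurry3 G)"
    and H: "\<And>t x e. (t, x, e) \<in> W \<Longrightarrow> H t x e = F t x e + k * G t x e"
  shows "hessian_e H t x (v /\<^sub>R c) = hessian_e F t x (v /\<^sub>R c) + k *\<^sub>R hessian_e G t x (v /\<^sub>R c)"
    and "force c H t x v = force c F t x v + k *\<^sub>R force c G t x v"
proof -
  note lin2 = directional_linear2[OF directional_d_e _ W F G H]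
  note lin = directional_linear[OF directional_d_x W
      twice_differentiable_on_imp_differentiable[OF F W(2)]
      twice_differentiable_on_imp_differentiable[OF G W(2)] H]
  show "hessian_e H t x (v /\<^sub>R c) = hessian_e F t x (v /\<^sub>R c) + k *\<^sub>R hessian_e G t x (v /\<^sub>R c)"
    by (simp add: hessian_e_def vec_eq_iff lin2[OF directional_d_e])
  show "force c H t x v = force c F t x v + k *\<^sub>R force c G t x v"
    by (simp add: force_def vec_eq_iff lin lin2[OF directional_d_x] lin2[OF directional_d_t]
        algebra_simps sum.distrib sum_distrib_left)
qed

section \<open>The Lagrangian of the modified dispersion relation\<close>

lemma bounded_linear_four: "bounded_linear (\<lambda>p. four (fst p) (snd p))"
  by (intro linear_conv_bounded_linear[THEN iffD1] linearI) (auto simp: four_def vec_eq_iff)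

lemma bounded_bilinear_matrix_vector_mult:
  "bounded_bilinear ((*v) :: real^'n^'m \<Rightarrow> real^'n \<Rightarrow> real^'m)"
proof (rule bilinear_conv_bounded_bilinear[THEN iffD1], unfold bilinear_def, intro conjI allI)
  show "linear (\<lambda>A :: real^'n^'m. A *v x)" for x
    by (rule linearI) (simp_all add: matrix_vector_mult_add_rdistrib scaleR_matrix_vector_assoc)
qed (rule matrix_vector_mul_linear)

text \<open>The open set on which the Lagrangians are differentiated, in the variable \<epsilon>
  instead of v and with the momentum of unit mass. Invertibility of the Hessian is a condition at
  the single state and remains in \<open>states\<close>.\<close>

definition state_domain ::
  "real \<Rightarrow> (real^4) set \<Rightarrow> (real^4 \<Rightarrow> real^4^4) \<Rightarrow> ((real^4) \<times> (real^4)) set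
    \<Rightarrow> (real \<times> (real^3) \<times> (real^3)) set" where
  "state_domain c U g D = {(t, x, e). four (c * t) x \<in> U \<and> 0 < gr_radicand c g t x e \<and>
     (four (c * t) x, gr_momentum c g 1 t x e) \<in> D}"

definition perturbation_lagrangian ::
  "real \<Rightarrow> (real^4 \<Rightarrow> real^4^4) \<Rightarrow> (real^4 \<Rightarrow> real^4 \<Rightarrow> real) \<Rightarrow> real \<Rightarrow> real^3 \<Rightarrow> real^3 \<Rightarrow> real" where
  "perturbation_lagrangian c g h t x e =
     (- 1 / 2) * (gr_lagrangian c g t x e * h (four (c * t) x) (gr_momentum c g 1 t x e))"

text \<open>The momentum is linear in M, so homogeneity produces \<open>M powr n\<close>, and the
  prefactor 1 / M^2 of h in the Lagrangian lowers the exponent by 2.\<close>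

lemma mdr_lagrangian_eq:
  assumes h: "homogeneous_of_degree n D h" and z: "(t, x, e) \<in> state_domain c U g D" and M: "M > 0"
  shows "mdr_lagrangian c g h \<xi> M t x e =
    gr_lagrangian c g t x e + (\<xi> * M powr (n - 2)) * perturbation_lagrangian c g h t x e"
proof -
  have "gr_momentum c g M t x e = M *\<^sub>R gr_momentum c g 1 t x e"
    by (simp add: gr_momentum_def)
  moreover have "h (four (c * t) x) (M *\<^sub>R gr_momentum c g 1 t x e)
      = M powr n * h (four (c * t) x) (gr_momentum c g 1 t x e)"
    using h z M unfolding homogeneous_of_degree_def state_domain_def by auto
  moreover have "M powr n = M powr (n - 2) * M\<^sup>2"
    using M by (simp add: powr_diff powr_numeral)
  ultimately show ?thesis
    using M by (simp add: mdr_lagrangian_def perturbation_lagrangian_def field_simps)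
qed

text \<open>Openness and regularity are obtained alternately along nested sets: each set is a
  preimage under a function whose continuity comes from its regularity on the previous set.\<close>

lemma state_domain_regularity:
  assumes U: "open U" and g: "smooth_on U g" and D: "open D"
    and h: "smooth_on D (\<lambda>(X, p). h X p)"
  shows open_state_domain: "open (state_domain c U g D)"
    and twice_differentiable_gr_lagrangian:
      "twice_differentiable_on (state_domain c U g D) (uncurry3 (gr_lagrangian c g))"
    and twice_differentiable_perturbation_lagrangian:
      "twice_differentiable_on (state_domain c U g D) (uncurry3 (perturbation_lagrangian c g h))"
proof -
  define X where "X z = four (c * fst z) (fst (snd z))" for z :: "real \<times> (real^3) \<times> (real^3)"
  define w where "w z = four 1 (snd (snd z))" for z :: "real \<times> (real^3) \<times> (real^3)"
  have fst_T: "twice_differentiable_on W (\<lambda>z. fst (f z))"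
    and snd_T: "twice_differentiable_on W (\<lambda>z. snd (f z))"
    if "twice_differentiable_on W f"
    for W and f :: "real \<times> (real^3) \<times> (real^3) \<Rightarrow> 'a::real_normed_vector \<times> 'b::real_normed_vector"
    using that bounded_linear_fst bounded_linear_snd twice_differentiable_on_bounded_linear by blast+
  have four_T: "twice_differentiable_on W (\<lambda>z. four (s z) (f z))"
    if "twice_differentiable_on W s" "twice_differentiable_on W f"
    for W s and f :: "real \<times> (real^3) \<times> (real^3) \<Rightarrow> real^3"
    using twice_differentiable_on_bounded_linear[OF bounded_linear_four
        twice_differentiable_on_Pair[OF that]] by simp
  have mult_T: "twice_differentiable_on W (\<lambda>z. r z * s z)"
    if "twice_differentiable_on W r" "twice_differentiable_on W s"
    for W and r s :: "real \<times> (real^3) \<times> (real^3) \<Rightarrow> real"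
    by (rule twice_differentiable_on_bounded_bilinear[OF bounded_bilinear_mult that])
  note T = twice_differentiable_on_const twice_differentiable_on_ident
  have X_T: "twice_differentiable_on W X" and w_T: "twice_differentiable_on W w" for W
    unfolding X_def w_def
    by (intro four_T mult_T T fst_T snd_T)+

  \<comment> \<open>Here g may be composed with the position.\<close>
  define W1 where "W1 = X -` U"
  have W1: "open W1"
    unfolding W1_def using twice_differentiable_on_imp_continuous_on[OF X_T[of UNIV]] U
    by (simp add: continuous_on_open_vimage open_vimage)
  have p_T: "twice_differentiable_on W1 (\<lambda>z. g (X z) *v w z)"
    by (intro twice_differentiable_on_bounded_bilinear[OF bounded_bilinear_matrix_vector_mult] w_T
        twice_differentiable_on_compose[OF smooth_on_imp_twice_differentiable_on[OF g] X_T W1])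
      (auto simp: W1_def)
  have R_eq: "uncurry3 (gr_radicand c g) = (\<lambda>z. w z \<bullet> (g (X z) *v w z))"
    by (simp add: gr_radicand_def X_def w_def)
  have R_T: "twice_differentiable_on W1 (uncurry3 (gr_radicand c g))"
    unfolding R_eq
    by (intro twice_differentiable_on_bounded_bilinear[OF bounded_bilinear_inner] w_T p_T)

  \<comment> \<open>A positive radicand keeps the square root and its reciprocal away from their
    singularity at 0.\<close>
  define W2 where "W2 = W1 \<inter> uncurry3 (gr_radicand c g) -` {0<..}"
  have W2: "open W2"
    unfolding W2_def
    by (rule continuous_open_preimage[OF twice_differentiable_on_imp_continuous_on[OF R_T] W1
          open_greaterThan])
  have sub12: "W2 \<subseteq> W1" by (auto simp: W2_def)
  have L_T: "twice_differentiable_on W2 (uncurry3 (gr_lagrangian c g))"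
    unfolding gr_lagrangian_def
    by (rule twice_differentiable_on_compose[OF twice_differentiable_on_sqrt
          twice_differentiable_on_subset[OF R_T sub12] W2])
      (auto simp: W2_def)
  have inv_T: "twice_differentiable_on W2 (\<lambda>z. inverse (uncurry3 (gr_lagrangian c g) z))"
    by (rule twice_differentiable_on_compose[OF twice_differentiable_on_inverse L_T W2])
      (auto simp: W2_def gr_lagrangian_def)
  have P_eq: "uncurry3 (gr_momentum c g 1) =
      (\<lambda>z. inverse (uncurry3 (gr_lagrangian c g) z) *\<^sub>R (g (X z) *v w z))"
    by (simp add: gr_momentum_def X_def w_def divide_inverse)
  have "twice_differentiable_on W2 (uncurry3 (gr_momentum c g 1))"
    unfolding P_eq
    by (intro inv_T twice_differentiable_on_subset[OF p_T sub12]
        twice_differentiable_on_bounded_bilinear[OF bounded_bilinear_scaleR])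
  then have Q_T: "twice_differentiable_on W2 (\<lambda>z. (X z, uncurry3 (gr_momentum c g 1) z))"
    by (rule twice_differentiable_on_Pair[OF X_T])

  \<comment> \<open>The last restriction puts the momentum into D, where h is smooth.\<close>
  have W_eq: "state_domain c U g D = W2 \<inter> (\<lambda>z. (X z, uncurry3 (gr_momentum c g 1) z)) -` D"
    by (auto simp: state_domain_def W2_def W1_def X_def)
  show W: "open (state_domain c U g D)"
    unfolding W_eq
    by (rule continuous_open_preimage[OF twice_differentiable_on_imp_continuous_on[OF Q_T] W2 D])
  have sub: "state_domain c U g D \<subseteq> W2" by (auto simp: W_eq)
  show L: "twice_differentiable_on (state_domain c U g D) (uncurry3 (gr_lagrangian c g))"
    by (rule twice_differentiable_on_subset[OF L_T sub])
  have "twice_differentiable_on (state_domain c U g D)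
      (\<lambda>z. (\<lambda>(X, p). h X p) (X z, uncurry3 (gr_momentum c g 1) z))"
    by (rule twice_differentiable_on_compose[OF smooth_on_imp_twice_differentiable_on[OF h]
          twice_differentiable_on_subset[OF Q_T sub] W])
      (auto simp: W_eq)
  then have "twice_differentiable_on (state_domain c U g D)
      (\<lambda>z. h (X z) (uncurry3 (gr_momentum c g 1) z))"
    by simp
  from mult_T[OF T(1)[of _ "- 1 / 2"] mult_T[OF L this]]
  show "twice_differentiable_on (state_domain c U g D) (uncurry3 (perturbation_lagrangian c g h))"
    by (simp add: perturbation_lagrangian_def X_def)
qed

lemma equation_of_motion_mdr_iff:
  assumes "open U" "smooth_on U g" "open D" "smooth_on D (\<lambda>(X, p). h X p)"
    and h: "homogeneous_of_degree n D h" and M: "M > 0"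
    and state: "(t, x, v /\<^sub>R c) \<in> state_domain c U g D"
  shows "equation_of_motion c (mdr_lagrangian c g h \<xi> M) t x v a \<longleftrightarrow>
    (hessian_e (gr_lagrangian c g) t x (v /\<^sub>R c)
      + (\<xi> * M powr (n - 2)) *\<^sub>R hessian_e (perturbation_lagrangian c g h) t x (v /\<^sub>R c)) *v a
    = force c (gr_lagrangian c g) t x v
      + (\<xi> * M powr (n - 2)) *\<^sub>R force c (perturbation_lagrangian c g h) t x v"
proof -
  note lin = hessian_force_linear[OF open_state_domain[OF assms(1-4)] state
      twice_differentiable_gr_lagrangian[OF assms(1-4)]
      twice_differentiable_perturbation_lagrangian[OF assms(1-4)] mdr_lagrangian_eq[OF h _ M]]
  show ?thesis unfolding equation_of_motion_iff by (simp add: lin)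
qed

text \<open>Independence of the mass is expressed by quantifier order: both acceleration fields are
  chosen before \<Xi> and all masses.\<close>

theorem mainTheorem4:
  fixes c n :: real
    and U :: "(real^4) set"
    and g :: "real^4 \<Rightarrow> real^4^4"
    and D :: "((real^4) \<times> (real^4)) set"
    and h :: "real^4 \<Rightarrow> real^4 \<Rightarrow> real"
    and \<gamma> :: "real^4 \<Rightarrow> real^3^3"
  assumes "c > 0"
    and "open U"
    and "lorentzian_metric_on U g"
    and "conic_domain U D"
    and "smooth_on D (\<lambda>(X, p). h X p)"
    and "homogeneous_of_degree n D h"
    and "\<And>X. X \<in> U \<Longrightarrow> positive_definite (\<gamma> X)"
  shows "\<exists>a\<^sub>G\<^sub>R \<Delta>a :: real \<Rightarrow> real^3 \<Rightarrow> real^3 \<Rightarrow> real^3.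
    \<forall>\<Xi> :: real \<Rightarrow> real. \<forall>(t, x, v) \<in> states c U g D.
      (\<forall>M>0.
        (\<forall>\<^sub>F s in nhds 0. \<exists>!a. equation_of_motion c (mdr_lagrangian c g h (s * \<Xi> M) M) t x v a) \<and>
        acceleration c g h 0 M t x v = a\<^sub>G\<^sub>R t x v \<and>
        ((\<lambda>s. acceleration c g h (s * \<Xi> M) M t x v) has_vector_derivative
           (\<Xi> M * M powr (n - 2)) *\<^sub>R \<Delta>a t x v) (at 0)) \<and>
      (a\<^sub>G\<^sub>R t x v \<noteq> 0 \<longrightarrow>
        (\<forall>M1>0. \<forall>M2>0.
          (\<lambda>s. eotvos_factor (\<gamma> (four (c * t) x))
                 (acceleration c g h (s * \<Xi> M1) M1 t x v)
                 (acceleration c g h (s * \<Xi> M2) M2 t x v)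
               - s * (\<bar>\<Xi> M1 * M1 powr (n - 2) - \<Xi> M2 * M2 powr (n - 2)\<bar> *
                      (metric_norm (\<gamma> (four (c * t) x)) (\<Delta>a t x v) /
                       metric_norm (\<gamma> (four (c * t) x)) (a\<^sub>G\<^sub>R t x v))))
          \<in> o[at_right 0](\<lambda>s. s)))"
proof -
  define A where "A t x v = hessian_e (gr_lagrangian c g) t x (v /\<^sub>R c)" for t x v
  define B where "B t x v = hessian_e (perturbation_lagrangian c g h) t x (v /\<^sub>R c)" for t x v
  define b where "b = force c (gr_lagrangian c g)"
  define d where "d = force c (perturbation_lagrangian c g h)"
  \<comment> \<open>Total functions of the state; they carry meaning only on \<open>states\<close>,
    where A is invertible.\<close>
  define a0 where "a0 t x v = matrix_inv (A t x v) *v b t x v" for t x v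
  define \<Delta> where "\<Delta> t x v = matrix_inv (A t x v) *v (d t x v - B t x v *v a0 t x v)" for t x v
  have g: "smooth_on U g" and D: "open D"
    using assms(3,4) by (auto simp: lorentzian_metric_on_def conic_domain_def)
  show ?thesis
  proof (rule exI[of _ a0], rule exI[of _ \<Delta>], intro allI ballI case_prodI2, goal_cases)
    case (1 \<Xi> _ t _ x v)
    then have A: "invertible (A t x v)" and X: "four (c * t) x \<in> U"
      and z: "(t, x, v /\<^sub>R c) \<in> state_domain c U g D"
      by (auto simp: states_def state_domain_def A_def Let_def)
    \<comment> \<open>Associating s to the left of k = \<Xi>(M) M^(n-2) gives a perturbation in s
      with fixed matrix k B and fixed vector k d.\<close>
    have eom: "equation_of_motion c (mdr_lagrangian c g h (s * \<Xi> M) M) t x v a \<longleftrightarrow>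
        (A t x v + s *\<^sub>R ((\<Xi> M * M powr (n - 2)) *\<^sub>R B t x v)) *v a
        = b t x v + s *\<^sub>R ((\<Xi> M * M powr (n - 2)) *\<^sub>R d t x v)" if "M > 0" for s M a
      using equation_of_motion_mdr_iff[OF assms(2) g D assms(5,6) that z]
      by (simp add: A_def B_def b_def d_def mult.assoc)
    have unique: "\<forall>\<^sub>F s in nhds 0. \<exists>!a. equation_of_motion c (mdr_lagrangian c g h (s * \<Xi> M) M) t x v a"
      if "M > 0" for M
      unfolding eom[OF that] by (rule linear_system_perturbation(1)[OF A])
    have GR: "acceleration c g h 0 M t x v = a0 t x v" if "M > 0" for M
      using eom[OF that, of 0]
      by (simp add: acceleration_def a0_def linear_system_iff[OF A])
    have deriv: "((\<lambda>s. acceleration c g h (s * \<Xi> M) M t x v) has_vector_derivative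
        (\<Xi> M * M powr (n - 2)) *\<^sub>R \<Delta> t x v) (at 0)" if "M > 0" for M
    proof -
      \<comment> \<open>The first-order term is linear in the pair (B, d), so k factors out of
        it.\<close>
      have "matrix_inv (A t x v) *v ((\<Xi> M * M powr (n - 2)) *\<^sub>R d t x v
          - ((\<Xi> M * M powr (n - 2)) *\<^sub>R B t x v) *v a0 t x v) = (\<Xi> M * M powr (n - 2)) *\<^sub>R \<Delta> t x v"
        by (simp only: \<Delta>_def scaleR_matrix_vector_assoc[symmetric] scaleR_diff_right[symmetric]
            matrix_vector_mult_scaleR)
      then show ?thesis
        using linear_system_perturbation(2)[OF A, of "(\<Xi> M * M powr (n - 2)) *\<^sub>R B t x v" "b t x v"
            "(\<Xi> M * M powr (n - 2)) *\<^sub>R d t x v"]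
        unfolding acceleration_def eom[OF that] a0_def by simp
    qed
    show ?case
      using unique GR deriv
      by (intro conjI allI impI eotvos_factor_first_order assms(7) X) simp_all
  qed
qed

end
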